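(* Let $n\geq 4$ and let $L_n$ be the line graph of an $n$-dimensional hypercube-like network. Then $L_n$ is $(4n-10)$-conditional edge-fault-tolerant strongly Menger edge connected. Further, if $k>4n-10$, then $L_n$ is not $k$-conditional edge-fault-tolerant strongly Menger edge connected.
   Context: For two disjoint graphs $G_1,G_2$ with the same number of vertices and a bijection $f:V(G_1)\to V(G_2)$, $G_1\oplus_f G_2$ denotes the graph obtained from $G_1\cup G_2$ by adding the edges $(v,f(v))$ for all $v\in V(G_1)$. The $n$-dimensional hypercube-like networks are defined recursively: $K_2$ is the only $1$-dimensional hypercube-like network; for $n\geq 2$, if $Q^1_{n-1}$ and $Q^2_{n-1}$ are (disjoint) $(n-1)$-dimensional hypercube-like networks, then $Q^1_{n-1}\oplus_f Q^2_{n-1}$ is an $n$-dimensional hypercube-like network for every bijection $f:V(Q^1_{n-1})\to V(Q^2_{n-1})$. The line graph $L(G)$ of a graph $G$ has vertex set $E(G)$, two vertices being adjacent iff the corresponding edges share an end-vertex. A connected graph $G$ is strongly Menger edge connected if for any two distinct vertices $u,v$ of $G$ there are $\min\{\deg_G(u),\deg_G(v)\}$ edge-disjoint $(u,v)$-paths in $G$. For a positive integer $m$, a connected graph $G$ is $m$-conditional edge-fault-tolerant strongly Menger edge connected if $G-F$ is strongly Menger edge connected for every edge set $F\subseteq E(G)$ with $|F|\leq m$ and minimum degree $\delta(G-F)\geq 2$ (degrees being taken in $G-F$). *)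

theory Defs
  imports Main
begin

text \<open>Undirected simple graphs: an edge is the two-element set of its end-vertices.\<close>

record 'a graph =
  verts :: "'a set"
  edges :: "'a set set"

definition degree :: "'a graph \<Rightarrow> 'a \<Rightarrow> nat" where
  "degree G v = card {e \<in> edges G. v \<in> e}"

text \<open>Meaningful for graphs with a finite nonempty vertex set only.\<close>

definition min_degree :: "'a graph \<Rightarrow> nat" where
  "min_degree G = Min (degree G ` verts G)"

definition delete_edges :: "'a graph \<Rightarrow> 'a set set \<Rightarrow> 'a graph" where
  "delete_edges G F = \<lparr>verts = verts G, edges = edges G - F\<rparr>"

definition path_edges :: "'a list \<Rightarrow> 'a set set" where
  "path_edges p = {{p ! i, p ! Suc i} | i. Suc i < length p}"

definition is_path :: "'a graph \<Rightarrow> 'a \<Rightarrow> 'a \<Rightarrow> 'a list \<Rightarrow> bool" where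
  "is_path G u v p \<longleftrightarrow>
     p \<noteq> [] \<and> hd p = u \<and> last p = v \<and> distinct p \<and>
     set p \<subseteq> verts G \<and> path_edges p \<subseteq> edges G"

definition connected_graph :: "'a graph \<Rightarrow> bool" where
  "connected_graph G \<longleftrightarrow>
     verts G \<noteq> {} \<and> (\<forall>u \<in> verts G. \<forall>v \<in> verts G. \<exists>p. is_path G u v p)"

definition strongly_Menger_edge_connected :: "'a graph \<Rightarrow> bool" where
  "strongly_Menger_edge_connected G \<longleftrightarrow>
     connected_graph G \<and>
     (\<forall>u \<in> verts G. \<forall>v \<in> verts G. u \<noteq> v \<longrightarrow>
        (\<exists>P. finite P \<and> card P = min (degree G u) (degree G v) \<and>
             (\<forall>p \<in> P. is_path G u v p) \<and>
             pairwise (\<lambda>p q. disjnt (path_edges p) (path_edges q)) P))"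

definition conditional_eft_strongly_Menger :: "nat \<Rightarrow> 'a graph \<Rightarrow> bool" where
  "conditional_eft_strongly_Menger m G \<longleftrightarrow>
     connected_graph G \<and>
     (\<forall>F. F \<subseteq> edges G \<longrightarrow> finite F \<longrightarrow> card F \<le> m \<longrightarrow>
        min_degree (delete_edges G F) \<ge> 2 \<longrightarrow>
        strongly_Menger_edge_connected (delete_edges G F))"

definition line_graph :: "'a graph \<Rightarrow> 'a set graph" where
  "line_graph G =
     \<lparr>verts = edges G,
      edges = {{e, e'} | e e'. e \<in> edges G \<and> e' \<in> edges G \<and> e \<noteq> e' \<and> e \<inter> e' \<noteq> {}}\<rparr>"

definition matching_join :: "('a \<Rightarrow> 'a) \<Rightarrow> 'a graph \<Rightarrow> 'a graph \<Rightarrow> 'a graph" where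
  "matching_join f G\<^sub>1 G\<^sub>2 =
     \<lparr>verts = verts G\<^sub>1 \<union> verts G\<^sub>2,
      edges = edges G\<^sub>1 \<union> edges G\<^sub>2 \<union> {{v, f v} | v. v \<in> verts G\<^sub>1}\<rparr>"

text \<open>The base case admits every copy of \<open>K\<^sub>2\<close>, so the predicate is
  invariant under renaming vertices within the type \<open>'a\<close>.\<close>

inductive hypercube_like :: "nat \<Rightarrow> 'a graph \<Rightarrow> bool" where
  K2: "u \<noteq> v \<Longrightarrow> hypercube_like 1 \<lparr>verts = {u, v}, edges = {{u, v}}\<rparr>"
| join: "\<lbrakk>hypercube_like n G\<^sub>1; hypercube_like n G\<^sub>2; verts G\<^sub>1 \<inter> verts G\<^sub>2 = {};
         bij_betw f (verts G\<^sub>1) (verts G\<^sub>2)\<rbrakk>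
    \<Longrightarrow> hypercube_like (Suc n) (matching_join f G\<^sub>1 G\<^sub>2)"

end

theory Submission
  imports Defs
begin

text \<open>
  By the edge version of Menger's theorem it suffices to bound, for a set \<open>S\<close> of vertices of
  \<open>L\<^sub>n\<close> separating \<open>u\<close> from \<open>v\<close>, the number of non-faulty edges leaving \<open>S\<close> from below. If \<open>S\<close> or its
  complement has at most two elements, minimum degree \<open>2\<close> is enough. Otherwise \<open>S\<close> is a set of
  edges of the network, and \<open>\<Sum> s\<^sub>x (n - s\<^sub>x)\<close> edges of \<open>L\<^sub>n\<close> leave it, where \<open>s\<^sub>x\<close> counts the edges
  of \<open>S\<close> at the vertex \<open>x\<close>. This sum is at least \<open>6n - 12 = (4n - 10) + (2n - 2)\<close>: it is large if
  many vertices are mixed (\<open>0 < s\<^sub>x < n\<close>), and if there are few, then \<open>n\<close>-connectedness forces \<open>S\<close>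
  or its complement to live on at most five vertices, where triangle-freeness gives the bound.
  The minimum \<open>6n - 12\<close> is attained by three edges at a common vertex, which yields sharpness.
\<close>

section \<open>Edge cuts and unit flows\<close>

text \<open>The record type admits arbitrary sets as edges; this predicate carries the
  well-formedness and finiteness on which the counting rests.\<close>

definition simple_graph :: "'a graph \<Rightarrow> bool" where
  "simple_graph G \<longleftrightarrow> finite (verts G) \<and>
     (\<forall>e \<in> edges G. \<exists>x y. x \<noteq> y \<and> e = {x, y} \<and> x \<in> verts G \<and> y \<in> verts G)"

definition edge_cut :: "'a graph \<Rightarrow> 'a set \<Rightarrow> 'a set set" where
  "edge_cut G S = {e \<in> edges G. e \<inter> S \<noteq> {} \<and> \<not> e \<subseteq> S}"

lemma simple_graphE:
  assumes "simple_graph G" "e \<in> edges G"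
  obtains x y where "x \<noteq> y" "e = {x, y}" "x \<in> verts G" "y \<in> verts G"
  using assms unfolding simple_graph_def by blast

lemma simple_graph_edgeD:
  assumes "simple_graph G" "{x, y} \<in> edges G"
  shows "x \<noteq> y" "x \<in> verts G" "y \<in> verts G"
  using simple_graphE[OF assms] by (metis doubleton_eq_iff)+

lemma simple_graph_edge_subset:
  assumes "simple_graph G" "e \<in> edges G"
  shows "e \<subseteq> verts G"
  using simple_graphE[OF assms] by blast

lemma simple_graph_finite_edges:
  assumes "simple_graph G"
  shows "finite (edges G)"
proof (rule finite_subset)
  show "edges G \<subseteq> Pow (verts G)" using assms simple_graph_edge_subset by auto
  show "finite (Pow (verts G))" using assms by (simp add: simple_graph_def)
qed

lemma simple_graph_delete_edges:
  "simple_graph G \<Longrightarrow> simple_graph (delete_edges G F)"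
  by (auto simp: simple_graph_def delete_edges_def)

lemma edge_cut_complement:
  assumes "simple_graph G" "S \<subseteq> verts G"
  shows "edge_cut G (verts G - S) = edge_cut G S"
  using assms simple_graph_edge_subset[of G] unfolding edge_cut_def by blast

section \<open>Paths crossing cuts, and paths obtained from reachability\<close>

lemma path_edges_Nil [simp]: "path_edges [] = {}"
  and path_edges_single [simp]: "path_edges [a] = {}"
  by (auto simp: path_edges_def)

lemma path_edges_Cons_Cons [simp]:
  "path_edges (a # b # p) = insert {a, b} (path_edges (b # p))"
proof -
  have "{i. Suc i < length (a # b # p)} = insert 0 (Suc ` {i. Suc i < length (b # p)})"
    by (auto simp: image_iff gr0_conv_Suc less_Suc_eq_0_disj)
  moreover have "path_edges q = (\<lambda>i. {q ! i, q ! Suc i}) ` {i. Suc i < length q}" for q :: "'a list"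
    by (auto simp: path_edges_def)
  ultimately show ?thesis by (simp add: image_image)
qed

lemma path_edges_meet_edge_cut:
  assumes "p \<noteq> []" "hd p \<in> S" "last p \<notin> S" "path_edges p \<subseteq> edges G"
  shows "path_edges p \<inter> edge_cut G S \<noteq> {}"
  using assms
proof (induction p rule: induct_list012)
  case (3 a b p)
  then show ?case by (cases "b \<in> S") (auto simp: edge_cut_def)
qed auto

text \<open>Every path leaves \<open>S\<close> through some cut edge, and edge-disjointness makes
  the choice of one such edge per path injective. This easy half of Menger's theorem serves the
  sharpness proof.\<close>

lemma disjoint_paths_le_edge_cut:
  assumes "finite (edge_cut G S)" "u \<in> S" "v \<notin> S"
    and "\<forall>p \<in> P. is_path G u v p"
    and "pairwise (\<lambda>p q. disjnt (path_edges p) (path_edges q)) P"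
  shows "card P \<le> card (edge_cut G S)"
proof -
  have "\<forall>p \<in> P. \<exists>e. e \<in> path_edges p \<inter> edge_cut G S"
  proof
    fix p assume "p \<in> P"
    then have "is_path G u v p" using assms(4) by blast
    then show "\<exists>e. e \<in> path_edges p \<inter> edge_cut G S"
      using path_edges_meet_edge_cut[of p S G] assms(2,3) by (auto simp: is_path_def)
  qed
  then obtain g where g: "\<And>p. p \<in> P \<Longrightarrow> g p \<in> path_edges p \<inter> edge_cut G S"
    by metis
  have "inj_on g P"
  proof (rule inj_onI, rule ccontr)
    fix p q assume "p \<in> P" "q \<in> P" "g p = g q" "p \<noteq> q"
    then show False using g[of p] g[of q] pairwiseD[OF assms(5), of p q] by (auto simp: disjnt_iff)
  qed
  moreover have "g ` P \<subseteq> edge_cut G S" using g by blast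
  ultimately show ?thesis using assms(1) by (metis card_inj_on_le)
qed

lemma rtranclp_imp_distinct_path:
  assumes "R\<^sup>*\<^sup>* u v"
  shows "\<exists>p. p \<noteq> [] \<and> hd p = u \<and> last p = v \<and> distinct p \<and> successively R p"
  using assms
proof (induction rule: converse_rtranclp_induct)
  case base
  show ?case by (rule exI[of _ "[v]"]) simp
next
  case (step x y)
  then obtain p where p: "p \<noteq> []" "hd p = y" "last p = v" "distinct p" "successively R p"
    by blast
  show ?case
  proof (cases "x \<in> set p")
    case True
    \<comment> \<open>If the new vertex already lies on the path, the walk is shortened to the tail
      starting there, which keeps it distinct.\<close>
    then obtain a b where "p = a @ x # b" by (meson split_list)
    then show ?thesis
      using p by (intro exI[of _ "x # b"]) (auto simp: successively_append_iff)
  next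
    case False
    then show ?thesis
      using p step.hyps by (intro exI[of _ "x # p"]) (auto simp: successively_Cons)
  qed
qed

lemma successively_path_in_graph:
  assumes G: "simple_graph G" and R: "\<And>x y. R x y \<Longrightarrow> {x, y} \<in> edges G"
    and "p \<noteq> []" "hd p \<in> verts G" "successively R p"
  shows "set p \<subseteq> verts G \<and> path_edges p \<subseteq> edges G"
  using assms(3-)
proof (induction p rule: induct_list012)
  case (3 a b p)
  then have "{a, b} \<in> edges G" using R by simp
  then show ?case using 3 simple_graph_edgeD[OF G] by simp
qed simp_all

text \<open>One unit of flow along the path in antisymmetric form, so that augmenting by a path and
  removing one become pointwise addition and subtraction.\<close>

fun path_flow :: "'a list \<Rightarrow> 'a \<Rightarrow> 'a \<Rightarrow> int" where
  "path_flow (a # b # p) x y =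
     of_bool (x = a \<and> y = b) - of_bool (x = b \<and> y = a) + path_flow (b # p) x y"
| "path_flow _ x y = 0"

lemma path_flow_antisym: "path_flow p x y = - path_flow p y x"
proof -
  have "path_flow p x y + path_flow p y x = 0"
    by (induction p rule: induct_list012) (auto simp: conj_commute)
  then show ?thesis by linarith
qed

lemma path_flow_outside: "x \<notin> set p \<or> y \<notin> set p \<Longrightarrow> path_flow p x y = 0"
proof (induction p rule: induct_list012)
  case (3 a b p)
  then have "path_flow (b # p) x y = 0" "x = a \<Longrightarrow> y \<noteq> b" "x = b \<Longrightarrow> y \<noteq> a" by auto
  then show ?case unfolding path_flow.simps by auto
qed simp_all

text \<open>The net outflow telescopes along the path: what enters an inner vertex also leaves
  it.\<close>

lemma path_flow_net:
  assumes "finite V" "set p \<subseteq> V" "p \<noteq> []"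
  shows "(\<Sum>y\<in>V. path_flow p x y) = of_bool (x = hd p) - of_bool (x = last p)"
  using assms
proof (induction p rule: induct_list012)
  case (3 a b p)
  have "(\<Sum>y\<in>V. of_bool (x = a \<and> y = b) :: int) = of_bool (x = a)"
    "(\<Sum>y\<in>V. of_bool (x = b \<and> y = a) :: int) = of_bool (x = b)"
    using 3(3,4) by (cases "x = a"; cases "x = b"; simp)+
  moreover have "(\<Sum>y\<in>V. path_flow (b # p) x y) = of_bool (x = b) - of_bool (x = last (b # p))"
    using 3 by simp
  ultimately show ?case by (simp add: sum.distrib sum_subtractf)
qed simp_all

text \<open>The head of a distinct path does not recur, so the contribution of the first arc neither
  accumulates nor cancels.\<close>

lemma path_flow_pos:
  assumes "distinct p" "successively R p" "path_flow p x y > 0"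
  shows "path_flow p x y = 1 \<and> R x y"
  using assms
proof (induction p rule: induct_list012)
  case (3 a b p)
  show ?case
  proof (cases "x = a \<or> y = a")
    case True
    then have "path_flow (b # p) x y = 0" using 3 by (intro path_flow_outside) auto
    then show ?thesis using 3 by (auto split: if_splits simp: of_bool_def)
  next
    case False
    then show ?thesis using 3 by auto
  qed
qed auto

text \<open>Distinctness rules out lists such as \<open>[a, b, a]\<close>, where the two traversals
  cancel although the edge is used.\<close>

lemma path_flow_nonzero_iff:
  assumes "distinct p"
  shows "path_flow p x y \<noteq> 0 \<longleftrightarrow> {x, y} \<in> path_edges p"
  using assms
proof (induction p rule: induct_list012)
  case (3 a b p)
  have sub: "e \<subseteq> set q" if "e \<in> path_edges q" for e and q :: "'a list"
    using that by (auto simp: path_edges_def)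
  show ?case
  proof (cases "x = a \<or> y = a")
    case True
    then have "path_flow (b # p) x y = 0" using 3 by (intro path_flow_outside) auto
    moreover have "{x, y} \<notin> path_edges (b # p)" using True 3(3) sub[of "{x,y}" "b # p"] by auto
    ultimately show ?thesis using 3 by (auto simp: doubleton_eq_iff)
  next
    case False
    then show ?thesis using 3 by (auto simp: doubleton_eq_iff)
  qed
qed auto

section \<open>Integral flows with unit capacities and Menger's theorem\<close>

text \<open>An integral flow of value \<open>k\<close> from \<open>u\<close> to \<open>v\<close>
  with capacity one on every edge. Antisymmetry turns the upper bound into a lower one, so the
  values lie between -1 and 1 and vanish off the edges.\<close>

definition unit_flow :: "'a graph \<Rightarrow> 'a \<Rightarrow> 'a \<Rightarrow> nat \<Rightarrow> ('a \<Rightarrow> 'a \<Rightarrow> int) \<Rightarrow> bool" where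
  "unit_flow G u v k f \<longleftrightarrow>
     (\<forall>x y. f x y = - f y x) \<and>
     (\<forall>x y. f x y \<le> of_bool ({x, y} \<in> edges G)) \<and>
     (\<forall>x \<in> verts G. (\<Sum>y\<in>verts G. f x y) = int k * (of_bool (x = u) - of_bool (x = v)))"

lemma unit_flowD:
  assumes "unit_flow G u v k f"
  shows "f x y = - f y x"
    and "f x y \<le> of_bool ({x, y} \<in> edges G)"
    and "x \<in> verts G \<Longrightarrow> (\<Sum>y\<in>verts G. f x y) = int k * (of_bool (x = u) - of_bool (x = v))"
  using assms unfolding unit_flow_def by blast+

text \<open>Sum the net outflow over \<open>X\<close>: pairs inside \<open>X\<close> cancel by
  antisymmetry, and among the vertices of \<open>X\<close> only \<open>u\<close>
  contributes.\<close>

lemma unit_flow_across_cut: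
  assumes f: "unit_flow G u v k f" and V: "finite (verts G)"
    and X: "X \<subseteq> verts G" "u \<in> X" "v \<notin> X"
  shows "(\<Sum>x\<in>X. \<Sum>y\<in>verts G - X. f x y) = int k"
proof -
  have finX: "finite X" using V X finite_subset by blast
  have anti: "f x y = - f y x" for x y by (rule unit_flowD(1)[OF f])
  have "(\<Sum>x\<in>X. \<Sum>y\<in>X. f x y) = (\<Sum>x\<in>X. \<Sum>y\<in>X. - f y x)"
    by (intro sum.cong refl anti)
  also have "\<dots> = - (\<Sum>x\<in>X. \<Sum>y\<in>X. f y x)" by (simp add: sum_negf)
  also have "(\<Sum>x\<in>X. \<Sum>y\<in>X. f y x) = (\<Sum>x\<in>X. \<Sum>y\<in>X. f x y)" by (rule sum.swap)
  finally have inner: "(\<Sum>x\<in>X. \<Sum>y\<in>X. f x y) = 0" by simp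
  have "(\<Sum>x\<in>X. \<Sum>y\<in>verts G. f x y) = (\<Sum>x\<in>X. (\<Sum>y\<in>verts G - X. f x y) + (\<Sum>y\<in>X. f x y))"
    using sum.subset_diff[OF X(1) V] by (intro sum.cong) auto
  also have "\<dots> = (\<Sum>x\<in>X. \<Sum>y\<in>verts G - X. f x y)"
    by (simp add: sum.distrib inner)
  also have "(\<Sum>x\<in>X. \<Sum>y\<in>verts G. f x y)
      = (\<Sum>x\<in>X. int k * (of_bool (x = u) - of_bool (x = v)))"
    using X by (intro sum.cong refl unit_flowD(3)[OF f]) auto
  also have "\<dots> = (\<Sum>x\<in>X. if x = u then int k else 0)"
    using X by (intro sum.cong) auto
  also have "\<dots> = int k" using X finX by simp
  finally show ?thesis by simp
qed

text \<open>One Ford-Fulkerson step: either \<open>v\<close> is reachable in the residual graph and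
  the flow is augmented along a path, or the reachable set has a saturated cut, which is too
  small.\<close>

lemma unit_flow_augment:
  assumes G: "simple_graph G" and uv: "u \<in> verts G" "v \<in> verts G"
    and f: "unit_flow G u v j f"
    and cut: "\<And>S. S \<subseteq> verts G \<Longrightarrow> u \<in> S \<Longrightarrow> v \<notin> S \<Longrightarrow> j < card (edge_cut G S)"
  shows "\<exists>f'. unit_flow G u v (Suc j) f'"
proof -
  have V: "finite (verts G)" using G by (simp add: simple_graph_def)
  have anti: "f x y = - f y x" and cap: "f x y \<le> of_bool ({x, y} \<in> edges G)" for x y
    by (rule unit_flowD[OF f])+
  \<comment> \<open>The residual relation. Off the edges \<open>f x y\<close> and
    \<open>f y x\<close> are both at most 0, hence 0 by antisymmetry, so residual arcs run along
    edges only.\<close>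
  define R where "R x y \<longleftrightarrow> f x y < of_bool ({x, y} \<in> edges G)" for x y
  have R: "{x, y} \<in> edges G" if "R x y" for x y
    using that anti[of x y] cap[of y x]
    by (cases "{x, y} \<in> edges G") (simp_all add: R_def insert_commute)
  define X where "X = {x \<in> verts G. R\<^sup>*\<^sup>* u x}"
  have "R\<^sup>*\<^sup>* u v"
  proof (rule ccontr)
    assume "\<not> R\<^sup>*\<^sup>* u v"
    then have X: "X \<subseteq> verts G" "u \<in> X" "v \<notin> X" using uv by (auto simp: X_def)
    \<comment> \<open>An unsaturated arc out of \<open>X\<close> would make its head reachable. So
      \<open>j\<close> counts the arcs leaving \<open>X\<close>, and these cover the cut, against
      the assumption \<open>cut\<close>.\<close>
    have sat: "f x y = of_bool ({x, y} \<in> edges G)" if "x \<in> X" "y \<in> verts G - X" for x y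
    proof -
      have "\<not> R x y" using that by (auto simp: X_def dest: rtranclp.rtrancl_into_rtrancl)
      then show ?thesis using cap[of x y] by (simp add: R_def)
    qed
    let ?A = "{z \<in> X \<times> (verts G - X). {fst z, snd z} \<in> edges G}"
    have fin: "finite (X \<times> (verts G - X))" using V X finite_subset by blast
    have "int j = (\<Sum>x\<in>X. \<Sum>y\<in>verts G - X. of_bool ({x, y} \<in> edges G))"
      using unit_flow_across_cut[OF f V X] sat by simp
    also have "\<dots> = (\<Sum>z\<in>X \<times> (verts G - X). of_bool ({fst z, snd z} \<in> edges G))"
      unfolding sum.cartesian_product case_prod_unfold ..
    also have "\<dots> = (\<Sum>z\<in>?A. 1)"
      using fin by (intro sum.mono_neutral_cong_right) auto
    also have "\<dots> = int (card ?A)" by simp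
    finally have "j = card ?A" by simp
    moreover have "edge_cut G X \<subseteq> (\<lambda>z. {fst z, snd z}) ` ?A"
    proof
      fix e assume e: "e \<in> edge_cut G X"
      then have eG: "e \<in> edges G" by (simp add: edge_cut_def)
      then obtain x y where xy: "x \<noteq> y" "e = {x, y}" "x \<in> verts G" "y \<in> verts G"
        by (rule simple_graphE[OF G])
      then consider "x \<in> X" "y \<notin> X" | "y \<in> X" "x \<notin> X" using e by (auto simp: edge_cut_def)
      then have "(x, y) \<in> ?A \<or> (y, x) \<in> ?A"
        by cases (use xy eG in \<open>auto simp: insert_commute\<close>)
      then show "e \<in> (\<lambda>z. {fst z, snd z}) ` ?A"
        by (elim disjE rev_image_eqI) (simp_all add: xy insert_commute)
    qed
    then have "card (edge_cut G X) \<le> card ?A"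
      using fin by (intro surj_card_le) auto
    ultimately show False using cut[OF X] by simp
  qed
  then obtain p where p: "p \<noteq> []" "hd p = u" "last p = v" "distinct p" "successively R p"
    using rtranclp_imp_distinct_path by metis
  have pV: "set p \<subseteq> verts G"
    using successively_path_in_graph[OF G R p(1) _ p(5)] p uv by simp
  \<comment> \<open>Capacities are respected since, by integrality, an arc of the path has at least
    one unit of slack, and \<open>path_flow\<close> adds just one there.\<close>
  have "unit_flow G u v (Suc j) (\<lambda>x y. f x y + path_flow p x y)"
    unfolding unit_flow_def
  proof (intro conjI allI ballI)
    fix x y
    show "f x y + path_flow p x y = - (f y x + path_flow p y x)"
      using anti[of x y] path_flow_antisym[of p x y] by simp
    show "f x y + path_flow p x y \<le> of_bool ({x, y} \<in> edges G)"
    proof (cases "path_flow p x y > 0")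
      case True
      then show ?thesis using path_flow_pos[OF p(4,5), of x y] by (simp add: R_def)
    next
      case False
      then show ?thesis using cap[of x y] by simp
    qed
  next
    fix x assume "x \<in> verts G"
    then show "(\<Sum>y\<in>verts G. f x y + path_flow p x y)
        = int (Suc j) * (of_bool (x = u) - of_bool (x = v))"
      using unit_flowD(3)[OF f, of x] path_flow_net[OF V pV p(1), of x] p
      by (simp add: sum.distrib algebra_simps)
  qed
  then show ?thesis by blast
qed

text \<open>Strip one path along arcs of positive flow and delete its edges: what remains is a flow
  of value one less in the smaller graph. The induction therefore varies \<open>G\<close>, and the
  paths it returns avoid the stripped one automatically.\<close>

lemma unit_flow_decompose:
  assumes "simple_graph G" "u \<in> verts G" "v \<in> verts G" "u \<noteq> v" "unit_flow G u v k f"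
  shows "\<exists>P. finite P \<and> card P = k \<and> (\<forall>p \<in> P. is_path G u v p) \<and>
    pairwise (\<lambda>p q. disjnt (path_edges p) (path_edges q)) P"
  using assms
proof (induction k arbitrary: G f)
  case 0
  show ?case by (rule exI[of _ "{}"]) simp
next
  case (Suc k)
  note G = Suc.prems(1) and uv = Suc.prems(2-4) and f = Suc.prems(5)
  have V: "finite (verts G)" using G by (simp add: simple_graph_def)
  have anti: "f x y = - f y x" and cap: "f x y \<le> of_bool ({x, y} \<in> edges G)" for x y
    by (rule unit_flowD[OF f])+
  define R where "R x y \<longleftrightarrow> f x y > 0" for x y
  have R: "{x, y} \<in> edges G" "f x y = 1" if "R x y" for x y
    using that cap[of x y] by (cases "{x, y} \<in> edges G"; simp add: R_def)+
  define X where "X = {x \<in> verts G. R\<^sup>*\<^sup>* u x}"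
  \<comment> \<open>Otherwise the flow leaving the reachable set would be at most 0, whereas it
    equals \<open>Suc k\<close>.\<close>
  have "R\<^sup>*\<^sup>* u v"
  proof (rule ccontr)
    assume "\<not> R\<^sup>*\<^sup>* u v"
    then have X: "X \<subseteq> verts G" "u \<in> X" "v \<notin> X" using uv by (auto simp: X_def)
    have "f x y \<le> 0" if "x \<in> X" "y \<in> verts G - X" for x y
    proof -
      have "\<not> R x y" using that by (auto simp: X_def dest: rtranclp.rtrancl_into_rtrancl)
      then show ?thesis by (simp add: R_def)
    qed
    then have "(\<Sum>x\<in>X. \<Sum>y\<in>verts G - X. f x y) \<le> 0" by (intro sum_nonpos) auto
    then show False using unit_flow_across_cut[OF f V X] by simp
  qed
  then obtain p where p: "p \<noteq> []" "hd p = u" "last p = v" "distinct p" "successively R p"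
    using rtranclp_imp_distinct_path by metis
  have path: "is_path G u v p"
    using successively_path_in_graph[OF G R(1) p(1) _ p(5)] p uv by (simp add: is_path_def)
  let ?G' = "delete_edges G (path_edges p)"
  have "unit_flow ?G' u v k (\<lambda>x y. f x y - path_flow p x y)"
    unfolding unit_flow_def
  proof (intro conjI allI ballI)
    fix x y
    show "f x y - path_flow p x y = - (f y x - path_flow p y x)"
      using anti[of x y] path_flow_antisym[of p x y] by simp
    show "f x y - path_flow p x y \<le> of_bool ({x, y} \<in> edges ?G')"
    proof -
      \<comment> \<open>On an edge of the path, in either direction, the difference is 0 and fits
        the deleted capacity; elsewhere \<open>f\<close> is unchanged.\<close>
      consider "path_flow p x y > 0" | "path_flow p y x > 0" | "path_flow p x y = 0"
        using path_flow_antisym[of p x y] by linarith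
      then show ?thesis
      proof cases
        case 1
        then show ?thesis using path_flow_pos[OF p(4,5), of x y] R[of x y] by simp
      next
        case 2
        then show ?thesis
          using path_flow_pos[OF p(4,5), of y x] R[of y x] anti[of x y] path_flow_antisym[of p x y]
          by simp
      next
        case 3
        then show ?thesis
          using path_flow_nonzero_iff[OF p(4), of x y] cap[of x y] by (simp add: delete_edges_def)
      qed
    qed
  next
    fix x assume "x \<in> verts ?G'"
    then show "(\<Sum>y\<in>verts ?G'. f x y - path_flow p x y)
        = int k * (of_bool (x = u) - of_bool (x = v))"
      using unit_flowD(3)[OF f, of x] path path_flow_net[OF V _ p(1), of x] p
      by (simp add: is_path_def delete_edges_def sum_subtractf algebra_simps)
  qed
  moreover have "u \<in> verts ?G'" "v \<in> verts ?G'" using uv by (simp_all add: delete_edges_def)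
  ultimately obtain P where P: "finite P" "card P = k" "\<forall>q \<in> P. is_path ?G' u v q"
      "pairwise (\<lambda>p q. disjnt (path_edges p) (path_edges q)) P"
    using Suc.IH[OF simple_graph_delete_edges[OF G] _ _ uv(3)] by metis
  have PG: "is_path G u v q" "disjnt (path_edges q) (path_edges p)" if "q \<in> P" for q
    using P(3) that by (auto simp: is_path_def delete_edges_def disjnt_def)
  \<comment> \<open>Since \<open>u\<close> and \<open>v\<close> differ, \<open>p\<close> has an
    edge; thus it is not disjoint from itself, cannot belong to \<open>P\<close>, and raises the
    cardinality by one.\<close>
  have "path_edges p \<noteq> {}"
  proof -
    obtain a b q where "p = a # b # q"
      using p uv by (cases p rule: remdups_adj.cases) auto
    then show ?thesis by simp
  qed
  then have "p \<notin> P" using PG(2)[of p] by (auto simp: disjnt_def)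
  moreover have "pairwise (\<lambda>p q. disjnt (path_edges p) (path_edges q)) (insert p P)"
    unfolding pairwise_insert using P(4) PG(2) disjnt_sym by blast
  ultimately show ?case
    using P(1,2) PG(1) path by (intro exI[of _ "insert p P"]) simp
qed

text \<open>The hard half of Menger's theorem: augment the zero flow \<open>k\<close> times, then
  decompose it into paths.\<close>

lemma Menger_edge:
  assumes "simple_graph G" "u \<in> verts G" "v \<in> verts G" "u \<noteq> v"
    and "\<And>S. S \<subseteq> verts G \<Longrightarrow> u \<in> S \<Longrightarrow> v \<notin> S \<Longrightarrow> k \<le> card (edge_cut G S)"
  shows "\<exists>P. finite P \<and> card P = k \<and> (\<forall>p \<in> P. is_path G u v p) \<and>
    pairwise (\<lambda>p q. disjnt (path_edges p) (path_edges q)) P"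
proof -
  have "\<exists>f. unit_flow G u v j f" if "j \<le> k" for j
    using that
  proof (induction j)
    case 0
    have "unit_flow G u v 0 (\<lambda>_ _. 0)" by (simp add: unit_flow_def)
    then show ?case by blast
  next
    case (Suc j)
    then obtain f where "unit_flow G u v j f" by auto
    moreover have "j < card (edge_cut G S)" if "S \<subseteq> verts G" "u \<in> S" "v \<notin> S" for S
      using assms(5)[OF that] Suc.prems by simp
    ultimately show ?case by (rule unit_flow_augment[OF assms(1-3)])
  qed
  then show ?thesis using unit_flow_decompose[OF assms(1-4)] by blast
qed

section \<open>Structure of hypercube-like networks\<close>

text \<open>Assuming simplicity of the halves, and not \<open>hypercube_like\<close>, allows the
  locale to be used already in the induction that proves these networks simple.\<close>

locale simple_matching_join =
  fixes f :: "'a \<Rightarrow> 'a" and G\<^sub>1 G\<^sub>2 :: "'a graph"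
  assumes simple: "simple_graph G\<^sub>1" "simple_graph G\<^sub>2"
    and disjoint: "verts G\<^sub>1 \<inter> verts G\<^sub>2 = {}"
    and bij: "bij_betw f (verts G\<^sub>1) (verts G\<^sub>2)"
begin

lemma f_in [intro]: "x \<in> verts G\<^sub>1 \<Longrightarrow> f x \<in> verts G\<^sub>2"
  using bij by (auto dest: bij_betwE)

lemma f_surj: "y \<in> verts G\<^sub>2 \<Longrightarrow> \<exists>z \<in> verts G\<^sub>1. f z = y"
  using bij by (metis bij_betw_imp_surj_on imageE)

lemma f_neq: "x \<in> verts G\<^sub>1 \<Longrightarrow> f x \<noteq> x"
  using f_in[of x] disjoint by auto

lemma verts_join: "verts (matching_join f G\<^sub>1 G\<^sub>2) = verts G\<^sub>1 \<union> verts G\<^sub>2"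
  by (simp add: matching_join_def)

lemma simple_join: "simple_graph (matching_join f G\<^sub>1 G\<^sub>2)"
proof -
  have "\<exists>x y. x \<noteq> y \<and> e = {x, y} \<and> x \<in> verts G\<^sub>1 \<union> verts G\<^sub>2 \<and> y \<in> verts G\<^sub>1 \<union> verts G\<^sub>2"
    if e: "e \<in> edges (matching_join f G\<^sub>1 G\<^sub>2)" for e
  proof -
    consider "e \<in> edges G\<^sub>1" | "e \<in> edges G\<^sub>2" | v where "v \<in> verts G\<^sub>1" "e = {v, f v}"
      using e by (auto simp: matching_join_def)
    then show ?thesis
    proof cases
      case 1
      then show ?thesis by (rule simple_graphE[OF simple(1)]) blast
    next
      case 2
      then show ?thesis by (rule simple_graphE[OF simple(2)]) blast
    next
      case 3
      then show ?thesis using f_in f_neq by (metis UnCI)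
    qed
  qed
  then show ?thesis using simple by (simp add: simple_graph_def verts_join)
qed

lemma edge_left:
  assumes "x \<in> verts G\<^sub>1"
  shows "{x, y} \<in> edges (matching_join f G\<^sub>1 G\<^sub>2) \<longleftrightarrow> {x, y} \<in> edges G\<^sub>1 \<or> y = f x"
proof -
  have "{x, y} \<notin> edges G\<^sub>2" using simple_graph_edgeD(2)[OF simple(2), of x y] assms disjoint by blast
  moreover have "x \<noteq> f v" if "v \<in> verts G\<^sub>1" for v using that assms f_in[of v] disjoint by blast
  ultimately show ?thesis
    using assms by (auto simp: matching_join_def doubleton_eq_iff)
qed

lemma edge_right:
  assumes "x \<in> verts G\<^sub>2"
  shows "{x, y} \<in> edges (matching_join f G\<^sub>1 G\<^sub>2) \<longleftrightarrow>
    {x, y} \<in> edges G\<^sub>2 \<or> y \<in> verts G\<^sub>1 \<and> f y = x"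
proof -
  have "{x, y} \<notin> edges G\<^sub>1" using simple_graph_edgeD(2)[OF simple(1), of x y] assms disjoint by blast
  moreover have "x \<noteq> v" if "v \<in> verts G\<^sub>1" for v using that assms disjoint by blast
  ultimately show ?thesis
    using assms by (auto simp: matching_join_def doubleton_eq_iff)
qed

text \<open>Each vertex gains exactly its matching edge; on the second side, surjectivity of
  \<open>f\<close> supplies it and injectivity makes it the only one.\<close>

lemma degree_join:
  assumes "x \<in> verts (matching_join f G\<^sub>1 G\<^sub>2)"
  shows "degree (matching_join f G\<^sub>1 G\<^sub>2) x =
    Suc (if x \<in> verts G\<^sub>1 then degree G\<^sub>1 x else degree G\<^sub>2 x)"
proof (cases "x \<in> verts G\<^sub>1")
  case True
  have "{e \<in> edges (matching_join f G\<^sub>1 G\<^sub>2). x \<in> e} = insert {x, f x} {e \<in> edges G\<^sub>1. x \<in> e}"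
    (is "?L = ?R")
  proof (intro equalityI subsetI)
    fix e assume e: "e \<in> ?L"
    then obtain y where y: "e = {x, y}"
      using simple_graphE[OF simple_join, of e] by auto
    then show "e \<in> ?R" using e edge_left[OF True, of y] by auto
  next
    fix e assume "e \<in> ?R"
    then show "e \<in> ?L" using True by (auto simp: matching_join_def)
  qed
  moreover have "{x, f x} \<notin> edges G\<^sub>1"
    using simple_graph_edgeD(3)[OF simple(1), of x "f x"] f_in[OF True] disjoint by blast
  ultimately show ?thesis
    using True simple_graph_finite_edges[OF simple(1)] by (simp add: degree_def)
next
  case False
  then have x: "x \<in> verts G\<^sub>2" using assms by (simp add: verts_join)
  then obtain z where z: "z \<in> verts G\<^sub>1" "f z = x" using f_surj by blast
  have "{e \<in> edges (matching_join f G\<^sub>1 G\<^sub>2). x \<in> e} = insert {z, x} {e \<in> edges G\<^sub>2. x \<in> e}"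
    (is "?L = ?R")
  proof (intro equalityI subsetI)
    fix e assume e: "e \<in> ?L"
    then obtain y where y: "e = {x, y}"
      using simple_graphE[OF simple_join, of e] by auto
    moreover have "y = z" if "y \<in> verts G\<^sub>1" "f y = x"
      using that z bij by (auto simp: bij_betw_def inj_on_def)
    ultimately show "e \<in> ?R" using e edge_right[OF x, of y] by auto
  next
    fix e assume "e \<in> ?R"
    then show "e \<in> ?L" using z by (auto simp: matching_join_def)
  qed
  moreover have "{z, x} \<notin> edges G\<^sub>2"
    using simple_graph_edgeD(2)[OF simple(2), of z x] z disjoint by blast
  ultimately show ?thesis
    using False simple_graph_finite_edges[OF simple(2)] by (simp add: degree_def)
qed

end

section \<open>Invariants of hypercube-like networks, by induction over the joins\<close>

lemma hypercube_like_simple: "hypercube_like n G \<Longrightarrow> simple_graph G"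
proof (induction rule: hypercube_like.induct)
  case (K2 u v)
  then show ?case by (auto simp: simple_graph_def)
next
  case (join n G\<^sub>1 G\<^sub>2 f)
  then interpret simple_matching_join f G\<^sub>1 G\<^sub>2 by unfold_locales
  show ?case by (rule simple_join)
qed

lemma hypercube_like_joinD:
  assumes "hypercube_like n G\<^sub>1" "hypercube_like n G\<^sub>2" "verts G\<^sub>1 \<inter> verts G\<^sub>2 = {}"
    "bij_betw f (verts G\<^sub>1) (verts G\<^sub>2)"
  shows "simple_matching_join f G\<^sub>1 G\<^sub>2"
  using assms by (auto intro: simple_matching_join.intro hypercube_like_simple)

lemma hypercube_like_card_verts: "hypercube_like n G \<Longrightarrow> card (verts G) = 2 ^ n"
proof (induction rule: hypercube_like.induct)
  case (join n G\<^sub>1 G\<^sub>2 f)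
  then have "finite (verts G\<^sub>1)" "finite (verts G\<^sub>2)"
    using hypercube_like_simple by (auto simp: simple_graph_def)
  then show ?case using join by (simp add: matching_join_def card_Un_disjoint)
qed simp

lemma hypercube_like_degree:
  "hypercube_like n G \<Longrightarrow> x \<in> verts G \<Longrightarrow> degree G x = n"
proof (induction arbitrary: x rule: hypercube_like.induct)
  case (K2 u v)
  then have "{e \<in> {{u, v}}. x \<in> e} = {{u, v}}" by auto
  then show ?case by (simp add: degree_def)
next
  case (join n G\<^sub>1 G\<^sub>2 f)
  interpret simple_matching_join f G\<^sub>1 G\<^sub>2 using join.hyps by (rule hypercube_like_joinD)
  show ?case using join.IH join.prems degree_join[OF join.prems] by (auto simp: verts_join)
qed

text \<open>A triangle using both halves would have two vertices in one half matched to the same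
  vertex of the other, which a bijection forbids.\<close>

lemma hypercube_like_triangle_free:
  "hypercube_like n G \<Longrightarrow> {x, y} \<in> edges G \<Longrightarrow> {y, z} \<in> edges G \<Longrightarrow> {x, z} \<notin> edges G"
proof (induction arbitrary: x y z rule: hypercube_like.induct)
  case (K2 u v)
  then show ?case by (auto simp: doubleton_eq_iff)
next
  case (join n G\<^sub>1 G\<^sub>2 f)
  interpret simple_matching_join f G\<^sub>1 G\<^sub>2 using join.hyps by (rule hypercube_like_joinD)
  have inj: "a = b" if "a \<in> verts G\<^sub>1" "b \<in> verts G\<^sub>1" "f a = f b" for a b
    using that bij by (auto simp: bij_betw_def inj_on_def)
  let ?G = "matching_join f G\<^sub>1 G\<^sub>2"
  show ?case
  proof
    assume xz: "{x, z} \<in> edges ?G"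
    note edges = join.prems xz
    note ne = simple_graph_edgeD(1)[OF simple_join edges(1)]
      simple_graph_edgeD(1)[OF simple_join edges(2)] simple_graph_edgeD(1)[OF simple_join edges(3)]
    have cross: "b = f a" if "a \<in> verts G\<^sub>1" "b \<in> verts G\<^sub>2" "{a, b} \<in> edges ?G" for a b
      using that edge_left[of a b] simple_graph_edgeD(3)[OF simple(1), of a b] disjoint by blast
    have left: "{a, b} \<in> edges G\<^sub>1" if "a \<in> verts G\<^sub>1" "b \<in> verts G\<^sub>1" "{a, b} \<in> edges ?G" for a b
      using that edge_left[of a b] f_in[of a] disjoint by blast
    have right: "{a, b} \<in> edges G\<^sub>2" if "a \<in> verts G\<^sub>2" "b \<in> verts G\<^sub>2" "{a, b} \<in> edges ?G" for a b
      using that edge_right[of a b] disjoint by blast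
    have sym: "{y, x} \<in> edges ?G" "{z, y} \<in> edges ?G" "{z, x} \<in> edges ?G"
      using edges by (simp_all add: insert_commute)
    have V: "x \<in> verts G\<^sub>1 \<or> x \<in> verts G\<^sub>2" "y \<in> verts G\<^sub>1 \<or> y \<in> verts G\<^sub>2"
        "z \<in> verts G\<^sub>1 \<or> z \<in> verts G\<^sub>2"
      using simple_graph_edgeD(2,3)[OF simple_join edges(1)]
        simple_graph_edgeD(3)[OF simple_join edges(2)] by (auto simp: verts_join)
    \<comment> \<open>Either all three vertices share a half or one is alone. Alone in
      \<open>G\<^sub>1\<close> it would have two images (cases 3 to 5); alone in
      \<open>G\<^sub>2\<close> it would have two preimages, where injectivity is used (cases 6 to
      8).\<close>
    consider "x \<in> verts G\<^sub>1" "y \<in> verts G\<^sub>1" "z \<in> verts G\<^sub>1"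
      | "x \<in> verts G\<^sub>2" "y \<in> verts G\<^sub>2" "z \<in> verts G\<^sub>2"
      | "x \<in> verts G\<^sub>1" "y \<in> verts G\<^sub>2" "z \<in> verts G\<^sub>2"
      | "y \<in> verts G\<^sub>1" "x \<in> verts G\<^sub>2" "z \<in> verts G\<^sub>2"
      | "z \<in> verts G\<^sub>1" "x \<in> verts G\<^sub>2" "y \<in> verts G\<^sub>2"
      | "x \<in> verts G\<^sub>2" "y \<in> verts G\<^sub>1" "z \<in> verts G\<^sub>1"
      | "y \<in> verts G\<^sub>2" "x \<in> verts G\<^sub>1" "z \<in> verts G\<^sub>1"
      | "z \<in> verts G\<^sub>2" "x \<in> verts G\<^sub>1" "y \<in> verts G\<^sub>1"
      using V by blast
    then show False
    proof cases
      case 1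
      then show False using left edges join.IH(1)[of x y z] by blast
    next
      case 2
      then show False using right edges join.IH(2)[of x y z] by blast
    next
      case 3
      then show False using cross[of x y] cross[of x z] edges ne by simp
    next
      case 4
      then show False using cross[of y x] cross[of y z] edges sym ne by simp
    next
      case 5
      then show False using cross[of z x] cross[of z y] edges sym ne by simp
    next
      case 6
      then show False using cross[of y x] cross[of z x] inj[of y z] edges sym ne by simp
    next
      case 7
      then show False using cross[of x y] cross[of z y] inj[of x z] edges sym ne by simp
    next
      case 8
      then show False using cross[of x z] cross[of y z] inj[of x y] edges sym ne by simp
    qed
  qed
qed

text \<open>This is \<open>n\<close>-connectedness expressed by colourings, a form in which halves
  can be glued without building paths. When two halves of dimension \<open>n\<close> are joined,
  either both lose fewer than \<open>n\<close> vertices and some matching edge survives, or one half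
  is intact and every survivor of the other is matched into it.\<close>

lemma hypercube_like_connectivity:
  assumes "hypercube_like n G" "finite M" "card M < n"
    and "\<And>x y. {x, y} \<in> edges G \<Longrightarrow> x \<notin> M \<Longrightarrow> y \<notin> M \<Longrightarrow> c x = c y"
    and "x \<in> verts G - M" "y \<in> verts G - M"
  shows "c x = c y"
  using assms
proof (induction arbitrary: M x y rule: hypercube_like.induct)
  case (K2 u v)
  then have "M = {}" by simp
  moreover have "c u = c v" using K2.prems(3)[of u v] \<open>M = {}\<close> by simp
  ultimately show ?case using K2.prems(4,5) by auto
next
  case (join n G\<^sub>1 G\<^sub>2 f)
  interpret simple_matching_join f G\<^sub>1 G\<^sub>2 using join.hyps by (rule hypercube_like_joinD)
  let ?M1 = "M \<inter> verts G\<^sub>1" and ?M2 = "M \<inter> verts G\<^sub>2"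
  have fin: "finite (verts G\<^sub>1)" "finite (verts G\<^sub>2)" using simple by (auto simp: simple_graph_def)
  have cM: "card ?M1 + card ?M2 \<le> card M"
  proof -
    have "card ?M1 + card ?M2 = card (?M1 \<union> ?M2)"
      using join.prems(1) disjoint by (subst card_Un_disjoint) auto
    also have "\<dots> \<le> card M" using join.prems(1) by (intro card_mono) auto
    finally show ?thesis .
  qed
  have match: "c a = c (f a)" if "a \<in> verts G\<^sub>1" "a \<notin> M" "f a \<notin> M" for a
    using join.prems(3)[of a "f a"] edge_left[of a "f a"] that by blast
  have in1: "c a = c b" if "card ?M1 < n" "a \<in> verts G\<^sub>1 - M" "b \<in> verts G\<^sub>1 - M" for a b
  proof (rule join.IH(1)[of ?M1])
    show "c x = c y" if "{x, y} \<in> edges G\<^sub>1" "x \<notin> ?M1" "y \<notin> ?M1" for x y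
      using join.prems(3)[of x y] simple_graph_edgeD(2,3)[OF simple(1) that(1)] edge_left[of x y] that
      by blast
  qed (use that join.prems in auto)
  have in2: "c a = c b" if "card ?M2 < n" "a \<in> verts G\<^sub>2 - M" "b \<in> verts G\<^sub>2 - M" for a b
  proof (rule join.IH(2)[of ?M2])
    show "c x = c y" if "{x, y} \<in> edges G\<^sub>2" "x \<notin> ?M2" "y \<notin> ?M2" for x y
      using join.prems(3)[of x y] simple_graph_edgeD(2,3)[OF simple(2) that(1)] edge_right[of x y] that
      by blast
  qed (use that join.prems in auto)
  have n: "n \<ge> 1" using join.hyps(1) by (induction rule: hypercube_like.induct) auto
  obtain d where d: "\<And>a. a \<in> (verts G\<^sub>1 \<union> verts G\<^sub>2) - M \<Longrightarrow> c a = d"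
  proof -
    consider (both) "card ?M1 < n" "card ?M2 < n" | (one) "?M2 = {}" "card ?M2 < n"
      | (two) "?M1 = {}" "card ?M1 < n"
    proof -
      \<comment> \<open>At most \<open>n\<close> vertices are removed in all, so if one half loses
        \<open>n\<close> of them, the other loses none.\<close>
      have "card ?M1 < n \<and> card ?M2 < n \<or> card ?M2 = 0 \<or> card ?M1 = 0"
        using cM join.prems(2) by linarith
      then show thesis using that n join.prems(1) by (auto simp: card_eq_0_iff)
    qed
    then show thesis
    proof cases
      case both
      \<comment> \<open>A removed vertex blocks only one matching edge, so at most \<open>n\<close>
        of the \<open>2 ^ n\<close> matching edges are blocked.\<close>
      have "\<not> verts G\<^sub>1 \<subseteq> ?M1 \<union> {a \<in> verts G\<^sub>1. f a \<in> ?M2}"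
      proof
        let ?B = "{a \<in> verts G\<^sub>1. f a \<in> ?M2}"
        assume "verts G\<^sub>1 \<subseteq> ?M1 \<union> ?B"
        then have "card (verts G\<^sub>1) \<le> card (?M1 \<union> ?B)"
          using fin by (intro card_mono) auto
        also have "\<dots> \<le> card ?M1 + card ?B" by (rule card_Un_le)
        also have "card ?B \<le> card ?M2"
          using bij join.prems(1) by (intro card_inj_on_le[of f]) (auto simp: bij_betw_def inj_on_def)
        finally have "2 ^ n \<le> n"
          using cM join.prems(2) hypercube_like_card_verts[OF join.hyps(1)] by linarith
        then show False using less_exp[of n] by linarith
      qed
      then obtain a where a: "a \<in> verts G\<^sub>1 - M" "f a \<in> verts G\<^sub>2 - M" using f_in by blast
      have "c b = c a" if "b \<in> (verts G\<^sub>1 \<union> verts G\<^sub>2) - M" for b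
        using that in1[OF both(1) _ a(1), of b] in2[OF both(2) _ a(2), of b] match[of a] a by auto
      then show thesis by (rule that)
    next
      case one
      obtain a where a: "a \<in> verts G\<^sub>2"
        using hypercube_like_card_verts[OF join.hyps(2)] by fastforce
      have M: "b \<notin> M" if "b \<in> verts G\<^sub>2" for b using that one(1) by blast
      have "c b = c a" if "b \<in> (verts G\<^sub>1 \<union> verts G\<^sub>2) - M" for b
        using that match[of b] in2[OF one(2), of b a] in2[OF one(2), of "f b" a] f_in[of b] a M
        by auto
      then show thesis by (rule that)
    next
      case two
      obtain a where a: "a \<in> verts G\<^sub>1"
        using hypercube_like_card_verts[OF join.hyps(1)] by fastforce
      have M: "b \<notin> M" if "b \<in> verts G\<^sub>1" for b using that two(1) by blast
      have "c b = c a" if b: "b \<in> (verts G\<^sub>1 \<union> verts G\<^sub>2) - M" for b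
      proof (cases "b \<in> verts G\<^sub>1")
        case True
        then show ?thesis using b in1[OF two(2), of b a] a M by auto
      next
        case False
        then obtain z where "z \<in> verts G\<^sub>1" "f z = b" using b f_surj by blast
        then show ?thesis using b match[of z] in1[OF two(2), of z a] a M by auto
      qed
      then show thesis by (rule that)
    qed
  qed
  then show ?case using join.prems(4,5) by (simp add: verts_join)
qed

section \<open>Edge cuts of line graphs\<close>

lemma verts_line_graph [simp]: "verts (line_graph G) = edges G"
  by (simp add: line_graph_def)

lemma line_graph_edge_iff:
  "{e, e'} \<in> edges (line_graph G) \<longleftrightarrow>
     e \<in> edges G \<and> e' \<in> edges G \<and> e \<noteq> e' \<and> e \<inter> e' \<noteq> {}"
  by (auto simp: line_graph_def doubleton_eq_iff)

lemma line_graph_edgeE: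
  assumes "z \<in> edges (line_graph G)"
  obtains e e' where "z = {e, e'}" "e \<in> edges G" "e' \<in> edges G" "e \<noteq> e'" "e \<inter> e' \<noteq> {}"
  using assms by (auto simp: line_graph_def)

lemma simple_line_graph:
  assumes "simple_graph G"
  shows "simple_graph (line_graph G)"
  using simple_graph_finite_edges[OF assms]
  by (auto simp: simple_graph_def line_graph_def)

lemma simple_graph_edge_eqI:
  assumes "simple_graph G" "e \<in> edges G" "e' \<in> edges G" "x \<noteq> y" "{x, y} \<subseteq> e" "{x, y} \<subseteq> e'"
  shows "e = e'"
proof -
  have "d = {x, y}" if "d \<in> edges G" "{x, y} \<subseteq> d" for d
    using that(1) by (rule simple_graphE[OF assms(1)]) (use that(2) assms(4) in auto)
  then show ?thesis using assms by metis
qed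

text \<open>The neighbours of an edge are the other edges at either end; simplicity prevents any of
  them from being counted at both ends.\<close>

lemma line_graph_degree:
  assumes G: "simple_graph G" and e: "{a, b} \<in> edges G"
  shows "degree (line_graph G) {a, b} = (degree G a - 1) + (degree G b - 1)"
proof -
  let ?N = "\<lambda>x. {e \<in> edges G. x \<in> e} - {{a, b}}"
  have fin: "finite (?N x)" for x using simple_graph_finite_edges[OF G] by simp
  have ab: "a \<noteq> b" using simple_graph_edgeD[OF G e] by simp
  have "{z \<in> edges (line_graph G). {a, b} \<in> z} = (\<lambda>d. {{a, b}, d}) ` (?N a \<union> ?N b)"
    (is "?L = ?R")
  proof (intro equalityI subsetI)
    fix z assume "z \<in> ?L"
    then have z: "z \<in> edges (line_graph G)" "{a, b} \<in> z" by auto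
    from z(1) obtain c c' where "z = {c, c'}" by (rule line_graph_edgeE)
    with z(2) have "z = {{a, b}, c} \<or> z = {{a, b}, c'}" by auto
    then obtain d where d: "z = {{a, b}, d}" by blast
    then have "d \<in> ?N a \<union> ?N b" using z(1) by (simp add: line_graph_edge_iff) blast
    then show "z \<in> ?R" using d by blast
  next
    fix z assume "z \<in> ?R"
    then show "z \<in> ?L" using e by (auto simp: line_graph_edge_iff)
  qed
  moreover have "inj_on (\<lambda>d. {{a, b}, d}) (?N a \<union> ?N b)"
    by (auto simp: inj_on_def doubleton_eq_iff)
  ultimately have "degree (line_graph G) {a, b} = card (?N a \<union> ?N b)"
    by (simp add: degree_def card_image)
  also have "\<dots> = card (?N a) + card (?N b)"
  proof (rule card_Un_disjoint[OF fin fin])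
    have "d = {a, b}" if "d \<in> edges G" "a \<in> d" "b \<in> d" for d
      using simple_graph_edge_eqI[OF G that(1) e ab] that by simp
    then show "?N a \<inter> ?N b = {}" by auto
  qed
  also have "\<dots> = (degree G a - 1) + (degree G b - 1)"
    using e by (simp add: degree_def card_Diff_singleton)
  finally show ?thesis .
qed

text \<open>A pair of edges on different sides of the cut meets in at most one vertex, so pairs
  counted at different vertices give different edges of the line graph.\<close>

lemma line_graph_edge_cut:
  assumes G: "simple_graph G" and S: "S \<subseteq> edges G"
  shows "(\<Sum>x\<in>verts G. card {e \<in> S. x \<in> e} * card {e \<in> edges G - S. x \<in> e})
    \<le> card (edge_cut (line_graph G) S)"
proof -
  have finE: "finite (edges G)" by (rule simple_graph_finite_edges[OF G])
  then have finS: "finite S" using S finite_subset by blast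
  let ?T = "SIGMA x:verts G. {e \<in> S. x \<in> e} \<times> {e \<in> edges G - S. x \<in> e}"
  let ?h = "\<lambda>(x, (e, e')). {e, e'}"
  have "inj_on ?h ?T"
  proof (rule inj_onI)
    fix p q assume p: "p \<in> ?T" and q: "q \<in> ?T" and eq: "?h p = ?h q"
    obtain x e e' where p': "p = (x, e, e')" by (metis prod.collapse)
    obtain y d d' where q': "q = (y, d, d')" by (metis prod.collapse)
    have *: "e \<in> S" "e' \<in> edges G - S" "x \<in> e" "x \<in> e'" "d \<in> S" "d' \<in> edges G - S" "y \<in> d" "y \<in> d'"
      using p q p' q' by auto
    \<comment> \<open>Membership in \<open>S\<close> tells the two members of the unordered pair
      apart.\<close>
    have "e = d" "e' = d'" using eq * by (auto simp: p' q' doubleton_eq_iff)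
    moreover have "x = y"
      using simple_graph_edge_eqI[OF G, of e e' x y] * S calculation by auto
    ultimately show "p = q" by (simp add: p' q')
  qed
  moreover have "?h ` ?T \<subseteq> edge_cut (line_graph G) S"
    using S by (auto simp: edge_cut_def line_graph_edge_iff)
  moreover have "finite (edge_cut (line_graph G) S)"
    using simple_graph_finite_edges[OF simple_line_graph[OF G]] by (simp add: edge_cut_def)
  ultimately have "card ?T \<le> card (edge_cut (line_graph G) S)" by (rule card_inj_on_le)
  moreover have "card ?T = (\<Sum>x\<in>verts G. card {e \<in> S. x \<in> e} * card {e \<in> edges G - S. x \<in> e})"
    using G finS finE by (subst card_SigmaI) (auto simp: simple_graph_def card_cartesian_product)
  ultimately show ?thesis by simp
qed

section \<open>The lower bound 6n - 12 for cuts with two large sides\<close>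

lemma hypercube_like_degree_split:
  assumes "hypercube_like n G" "S \<subseteq> edges G" "x \<in> verts G"
  shows "card {e \<in> S. x \<in> e} + card {e \<in> edges G - S. x \<in> e} = n"
proof -
  have "finite (edges G)"
    using assms(1) by (intro simple_graph_finite_edges hypercube_like_simple)
  then have "card {e \<in> S. x \<in> e} + card {e \<in> edges G - S. x \<in> e}
      = card ({e \<in> S. x \<in> e} \<union> {e \<in> edges G - S. x \<in> e})"
    using assms(2) by (intro card_Un_disjoint[symmetric]) (auto intro: finite_subset)
  also have "{e \<in> S. x \<in> e} \<union> {e \<in> edges G - S. x \<in> e} = {e \<in> edges G. x \<in> e}"
    using assms(2) by auto
  finally show ?thesis
    using hypercube_like_degree[OF assms(1,3)] by (simp add: degree_def)
qed

text \<open>Regrouped by the edges xy of \<open>S\<close>, the sum has the terms 2n -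
  (\<open>s x + s y\<close>), so it suffices to bound \<open>s x + s y\<close> from above: by
  \<open>card S + 1\<close>, as only xy is counted at both ends, and by 5, as triangle-freeness
  makes the neighbours of x and y inside \<open>M\<close> disjoint. The set \<open>S\<close> will be
  either side of a cut.\<close>

lemma mixed_sum_edges_inside:
  assumes Q: "hypercube_like n G" and n: "n \<ge> 4" and S: "S \<subseteq> edges G" "3 \<le> card S"
    and M: "\<And>e. e \<in> S \<Longrightarrow> e \<subseteq> M" "finite M" "card M \<le> 5"
  shows "6 * n - 12 \<le> (\<Sum>x\<in>verts G. card {e \<in> S. x \<in> e} * card {e \<in> edges G - S. x \<in> e})"
proof -
  have G: "simple_graph G" by (rule hypercube_like_simple[OF Q])
  have finE: "finite (edges G)" by (rule simple_graph_finite_edges[OF G])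
  then have finS: "finite S" using S finite_subset by blast
  define s where "s x = card {e \<in> S. x \<in> e}" for x
  \<comment> \<open>The two bounds combined: \<open>s x + s y\<close> is at most 4 if
    \<open>card S = 3\<close>, and at most 5 otherwise.\<close>
  define K :: int where "K = (if card S = 3 then 2 * int n - 4 else 2 * int n - 5)"
  have edge: "K \<le> (\<Sum>x\<in>{x \<in> verts G. x \<in> e}. int n - int (s x))" if e: "e \<in> S" for e
  proof -
    have "e \<in> edges G" using e S by blast
    then obtain x y where xy: "x \<noteq> y" "e = {x, y}" "x \<in> verts G" "y \<in> verts G"
      by (rule simple_graphE[OF G])
    have "{z \<in> verts G. z \<in> e} = {x, y}" using xy by auto
    then have sum: "(\<Sum>x\<in>{x \<in> verts G. x \<in> e}. int n - int (s x)) = 2 * int n - int (s x + s y)"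
      using xy by simp
    have "s x + s y = card ({d \<in> S. x \<in> d} \<union> {d \<in> S. y \<in> d}) + card ({d \<in> S. x \<in> d} \<inter> {d \<in> S. y \<in> d})"
      unfolding s_def using finS by (intro card_Un_Int) auto
    also have "{d \<in> S. x \<in> d} \<inter> {d \<in> S. y \<in> d} = {e}"
      using simple_graph_edge_eqI[OF G _ _ xy(1), of _ e] e S xy by auto
    also have "card ({d \<in> S. x \<in> d} \<union> {d \<in> S. y \<in> d}) \<le> card S"
      using finS by (intro card_mono) auto
    finally have le1: "s x + s y \<le> card S + 1" by simp
    \<comment> \<open>Incident edges are replaced by neighbours, which lie in
      \<open>M\<close>.\<close>
    have nb: "s a = card {z. {a, z} \<in> S}" for a
    proof -
      have "{d \<in> S. a \<in> d} = (\<lambda>z. {a, z}) ` {z. {a, z} \<in> S}" (is "?L = ?R")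
      proof (intro equalityI subsetI)
        fix d assume d: "d \<in> ?L"
        then have "d \<in> edges G" using S by blast
        then obtain z where "d = {a, z}"
          by (rule simple_graphE[OF G]) (use d in auto)
        then show "d \<in> ?R" using d by auto
      qed auto
      then show ?thesis unfolding s_def by (simp add: card_image inj_on_def doubleton_eq_iff)
    qed
    have sub: "{z. {a, z} \<in> S} \<subseteq> M" for a using M(1) by blast
    have "s x + s y = card ({z. {x, z} \<in> S} \<union> {z. {y, z} \<in> S})"
      unfolding nb
    proof (rule card_Un_disjoint[symmetric])
      \<comment> \<open>A common neighbour would form a triangle with the edge
        \<open>e\<close>.\<close>
      show "{z. {x, z} \<in> S} \<inter> {z. {y, z} \<in> S} = {}"
        using hypercube_like_triangle_free[OF Q, of x y] e xy S by blast
    qed (use sub M(2) finite_subset in blast)+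
    also have "\<dots> \<le> card M" using sub M(2) by (intro card_mono) auto
    finally have "s x + s y \<le> 5" using M(3) by simp
    then show ?thesis using le1 unfolding sum K_def by auto
  qed
  \<comment> \<open>Three edges give 3(2n - 4) = 6n - 12; four or more give at least 8n - 20, which
    is no smaller precisely when n is at least 4.\<close>
  have "6 * int n - 12 \<le> int (card S) * K"
  proof (cases "card S = 3")
    case False
    then have "4 * (2 * int n - 5) \<le> int (card S) * (2 * int n - 5)"
      using S(2) n by (intro mult_right_mono) auto
    then show ?thesis using False n by (simp add: K_def)
  qed (simp add: K_def)
  also have "\<dots> \<le> (\<Sum>e\<in>S. \<Sum>x\<in>{x \<in> verts G. x \<in> e}. int n - int (s x))"
    using edge by (rule sum_bounded_below)
  also have "\<dots> = (\<Sum>x\<in>verts G. \<Sum>e\<in>{e \<in> S. x \<in> e}. int n - int (s x))"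
    using finS G by (intro sum.swap_restrict) (auto simp: simple_graph_def)
  also have "\<dots> = (\<Sum>x\<in>verts G. int (s x * card {e \<in> edges G - S. x \<in> e}))"
  proof (intro sum.cong refl)
    fix x assume "x \<in> verts G"
    then have "s x + card {e \<in> edges G - S. x \<in> e} = n"
      unfolding s_def by (rule hypercube_like_degree_split[OF Q S(1)])
    then have "int n - int (s x) = int (card {e \<in> edges G - S. x \<in> e})" by linarith
    then show "(\<Sum>e\<in>{e \<in> S. x \<in> e}. int n - int (s x))
        = int (s x * card {e \<in> edges G - S. x \<in> e})"
      by (simp add: s_def)
  qed
  finally show ?thesis unfolding s_def of_nat_sum[symmetric] by linarith
qed

text \<open>Sides with fewer than three elements must be excluded: a single edge of the network has
  a cut of only 2n - 2. They are handled by \<open>degree_le_small_edge_cut\<close>.\<close>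

lemma hypercube_like_line_edge_cut:
  assumes Q: "hypercube_like n G" and n: "n \<ge> 4"
    and S: "S \<subseteq> edges G" "3 \<le> card S" "3 \<le> card (edges G - S)"
  shows "6 * n - 12 \<le> card (edge_cut (line_graph G) S)"
proof -
  have G: "simple_graph G" by (rule hypercube_like_simple[OF Q])
  have finV: "finite (verts G)" using G by (simp add: simple_graph_def)
  have finE: "finite (edges G)" by (rule simple_graph_finite_edges[OF G])
  define s where "s x = card {e \<in> S. x \<in> e}" for x
  define t where "t x = card {e \<in> edges G - S. x \<in> e}" for x
  have st: "s x + t x = n" if "x \<in> verts G" for x
    unfolding s_def t_def by (rule hypercube_like_degree_split[OF Q S(1) that])
  define M where "M = {x \<in> verts G. s x \<noteq> 0 \<and> t x \<noteq> 0}"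
  have finM: "finite M" using finV by (simp add: M_def)
  have s0: "s x \<noteq> 0" if "e \<in> S" "x \<in> e" for e x
  proof -
    have "finite {e \<in> S. x \<in> e}" using finE S(1) by (auto intro: finite_subset)
    then show ?thesis using that by (auto simp: s_def)
  qed
  have t0: "t x \<noteq> 0" if "e \<in> edges G - S" "x \<in> e" for e x
    using that finE by (auto simp: t_def)
  have "6 * n - 12 \<le> (\<Sum>x\<in>verts G. s x * t x)"
  proof (cases "6 * n - 12 \<le> card M * (n - 1)")
    case True
    also have "card M * (n - 1) \<le> (\<Sum>x\<in>M. s x * t x)"
    proof -
      \<comment> \<open>Two positive factors with sum \<open>n\<close> have the smallest product
        when one of them is 1.\<close>
      have "n - 1 \<le> s x * t x" if x: "x \<in> M" for x
      proof -
        obtain i j where ij: "s x = Suc i" "t x = Suc j"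
          using x by (auto simp: M_def gr0_conv_Suc)
        then show ?thesis using st[of x] x by (auto simp: M_def)
      qed
      then show ?thesis using sum_bounded_below[of M "n - 1" "\<lambda>x. s x * t x"] by simp
    qed
    also have "\<dots> \<le> (\<Sum>x\<in>verts G. s x * t x)"
      using finV by (intro sum_mono2) (auto simp: M_def)
    finally show ?thesis .
  next
    case False
    have M5: "card M \<le> 5"
    proof (rule ccontr)
      assume "\<not> card M \<le> 5"
      then have "6 * (n - 1) \<le> card M * (n - 1)" by (intro mult_right_mono) auto
      then show False using False by linarith
    qed
    \<comment> \<open>With at most five mixed vertices only n = 4 and n = 5 are in question; there
      n(n - 1) is 12 and 20 while 6n - 12 is 12 and 18, so the previous case would have
      applied.\<close>
    have Mn: "card M < n"
    proof (rule ccontr)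
      assume "\<not> card M < n"
      then have "n \<le> card M" by simp
      then have "n * (n - 1) \<le> card M * (n - 1)" by (rule mult_right_mono) simp
      moreover have "n = 4 \<or> n = 5" using M5 n \<open>n \<le> card M\<close> by linarith
      ultimately show False using False by fastforce
    qed
    \<comment> \<open>An unmixed vertex has all its edges on one side of the cut, and adjacent
      unmixed vertices share an edge, hence the side. Removing fewer than \<open>n\<close> mixed
      vertices does not disconnect the network.\<close>
    have colour: "(s x = 0) = (s y = 0)" if "x \<in> verts G - M" "y \<in> verts G - M" for x y
    proof (rule hypercube_like_connectivity[OF Q finM Mn _ that])
      fix x y assume xy: "{x, y} \<in> edges G" "x \<notin> M" "y \<notin> M"
      have "x \<in> verts G" "y \<in> verts G" using simple_graph_edgeD[OF G xy(1)] by auto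
      then have *: "s x = 0 \<or> t x = 0" "s y = 0 \<or> t y = 0" using xy by (auto simp: M_def)
      show "(s x = 0) = (s y = 0)"
        using * s0[of "{x, y}" x] s0[of "{x, y}" y] t0[of "{x, y}" x] t0[of "{x, y}" y] xy(1)
        by (cases "{x, y} \<in> S") auto
    qed
    have inside: "e \<subseteq> M" if "e \<in> edges G" "\<And>x. x \<in> e \<Longrightarrow> x \<in> verts G - M \<Longrightarrow> False" for e
      using that simple_graph_edge_subset[OF G that(1)] by blast
    show ?thesis
    \<comment> \<open>Either all unmixed vertices avoid \<open>S\<close>, so that its edges lie
      within \<open>M\<close>, or they all avoid the complement, whose edges then lie within
      \<open>M\<close>.\<close>
    proof (cases "\<forall>x \<in> verts G - M. s x = 0")
      case True
      have "e \<subseteq> M" if "e \<in> S" for e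
      proof (rule inside)
        show "e \<in> edges G" using that S(1) by blast
        show False if "x \<in> e" "x \<in> verts G - M" for x
          using s0[OF \<open>e \<in> S\<close> that(1)] True that(2) by simp
      qed
      then show ?thesis
        unfolding s_def t_def using mixed_sum_edges_inside[OF Q n S(1,2) _ finM M5] by blast
    next
      case False
      then have nz: "s x \<noteq> 0" if "x \<in> verts G - M" for x using colour that by blast
      have tz: "t x = 0" if "x \<in> verts G - M" for x using nz[OF that] that by (auto simp: M_def)
      have "e \<subseteq> M" if "e \<in> edges G - S" for e
      proof (rule inside)
        show "e \<in> edges G" using that by blast
        show False if "x \<in> e" "x \<in> verts G - M" for x
          using t0[OF \<open>e \<in> edges G - S\<close> that(1)] tz[OF that(2)] by simp
      qed
      then have "6 * n - 12 \<le> (\<Sum>x\<in>verts G. card {e \<in> edges G - S. x \<in> e} *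
          card {e \<in> edges G - (edges G - S). x \<in> e})"
        using mixed_sum_edges_inside[OF Q n _ S(3) _ finM M5] by blast
      also have "edges G - (edges G - S) = S" using S(1) by blast
      finally show ?thesis unfolding s_def t_def by (simp add: mult.commute)
    qed
  qed
  also have "\<dots> \<le> card (edge_cut (line_graph G) S)"
    unfolding s_def t_def by (rule line_graph_edge_cut[OF G S(1)])
  finally show ?thesis .
qed

section \<open>Strong Menger edge connectivity of the line graphs\<close>

lemma finite_incident_edges: "simple_graph G \<Longrightarrow> finite {e \<in> edges G. x \<in> e}"
  using simple_graph_finite_edges by fastforce

lemma min_degree_ge_iff:
  assumes "finite (verts G)" "verts G \<noteq> {}"
  shows "k \<le> min_degree G \<longleftrightarrow> (\<forall>x \<in> verts G. k \<le> degree G x)"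
  using assms by (simp add: min_degree_def)

lemma edge_cut_delete_edges: "edge_cut (delete_edges G F) S = edge_cut G S - F"
  by (auto simp: edge_cut_def delete_edges_def)

text \<open>Only the edge joining \<open>u\<close> to a second vertex \<open>w\<close> of
  \<open>S\<close> can be missing from the cut, and \<open>w\<close>, having degree at least 2,
  compensates with another edge.\<close>

lemma degree_le_small_edge_cut:
  assumes G: "simple_graph G" and S: "finite S" "u \<in> S" "S \<subseteq> verts G" "card S \<le> 2"
    and deg: "\<And>x. x \<in> verts G \<Longrightarrow> 2 \<le> degree G x"
  shows "degree G u \<le> card (edge_cut G S)"
proof -
  have fin: "finite (edge_cut G S)"
    using simple_graph_finite_edges[OF G] by (simp add: edge_cut_def)
  have notin: "\<not> e \<subseteq> {x}" if "e \<in> edges G" for e x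
    using that by (rule simple_graphE[OF G]) auto
  show ?thesis
  proof (cases "S = {u}")
    case True
    then have "{e \<in> edges G. u \<in> e} \<subseteq> edge_cut G S"
      using notin by (auto simp: edge_cut_def)
    then show ?thesis unfolding degree_def using fin by (rule card_mono[rotated])
  next
    case False
    then obtain w where w: "w \<in> S" "w \<noteq> u" using S(2) by blast
    have Suw: "S = {u, w}"
      using S w by (intro card_seteq[symmetric]) auto
    let ?I = "\<lambda>x. {e \<in> edges G. x \<in> e} - {{u, w}}"
    have cut: "?I x \<subseteq> edge_cut G S" if "x \<in> S" for x
    proof
      fix e assume e: "e \<in> ?I x"
      have "\<not> e \<subseteq> {u, w}"
        using e notin[of e u] notin[of e w] by auto
      then show "e \<in> edge_cut G S" using e that Suw by (auto simp: edge_cut_def)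
    qed
    have disj: "?I u \<inter> ?I w = {}"
    proof -
      have "e = {u, w}" if "e \<in> edges G" "u \<in> e" "w \<in> e" for e
        using that(1) by (rule simple_graphE[OF G]) (use that w in auto)
      then show ?thesis by blast
    qed
    have ge: "degree G x - 1 \<le> card (?I x)" for x
      unfolding degree_def using diff_card_le_card_Diff[of "{{u, w}}" "{e \<in> edges G. x \<in> e}"] by simp
    \<comment> \<open>Both degrees are at least 2, so the truncated subtractions are exact and the
      second summand is at least 1.\<close>
    have "degree G u \<le> (degree G u - 1) + (degree G w - 1)"
      using deg[of u] deg[of w] S w by auto
    also have "\<dots> \<le> card (?I u) + card (?I w)" by (rule add_mono[OF ge ge])
    also have "\<dots> = card (?I u \<union> ?I w)"
      using disj finite_incident_edges[OF G] by (intro card_Un_disjoint[symmetric]) auto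
    also have "\<dots> \<le> card (edge_cut G S)"
      using fin cut S(2) w(1) by (intro card_mono) auto
    finally show ?thesis .
  qed
qed

section \<open>Tolerance of 4n - 10 faulty edges\<close>

lemma hypercube_like_line_degree:
  assumes "hypercube_like n G" "e \<in> edges G"
  shows "degree (line_graph G) e = 2 * n - 2"
proof -
  have G: "simple_graph G" by (rule hypercube_like_simple[OF assms(1)])
  from assms(2) obtain x y where xy: "x \<noteq> y" "e = {x, y}" "x \<in> verts G" "y \<in> verts G"
    by (rule simple_graphE[OF G])
  then show ?thesis
    using line_graph_degree[OF G, of x y] assms hypercube_like_degree[OF assms(1)] by simp
qed

lemma hypercube_like_edges_nonempty:
  assumes "hypercube_like n G" "n \<ge> 4"
  shows "edges G \<noteq> {}"
proof
  assume "edges G = {}"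
  moreover obtain x where "x \<in> verts G"
    using hypercube_like_card_verts[OF assms(1)] by fastforce
  ultimately show False
    using hypercube_like_degree[OF assms(1), of x] assms(2) by (simp add: degree_def)
qed

lemma line_graph_faulty_strongly_Menger:
  assumes Q: "hypercube_like n Q" and n: "n \<ge> 4"
    and F: "finite F" "card F \<le> 4 * n - 10"
    and deg: "2 \<le> min_degree (delete_edges (line_graph Q) F)"
  shows "strongly_Menger_edge_connected (delete_edges (line_graph Q) F)"
proof -
  let ?H = "delete_edges (line_graph Q) F"
  have G: "simple_graph Q" by (rule hypercube_like_simple[OF Q])
  have L: "simple_graph (line_graph Q)" by (rule simple_line_graph[OF G])
  have H: "simple_graph ?H" by (rule simple_graph_delete_edges[OF L])
  have V: "verts ?H = edges Q" by (simp add: delete_edges_def)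
  have finE: "finite (edges Q)" by (rule simple_graph_finite_edges[OF G])
  have ne: "edges Q \<noteq> {}" by (rule hypercube_like_edges_nonempty[OF Q n])
  have deg2: "2 \<le> degree ?H x" if "x \<in> verts ?H" for x
    using deg min_degree_ge_iff[of ?H 2] V finE ne that by auto
  have degle: "degree ?H x \<le> 2 * n - 2" if "x \<in> edges Q" for x
  proof -
    have "degree ?H x \<le> degree (line_graph Q) x"
      unfolding degree_def using finite_incident_edges[OF L]
      by (intro card_mono) (auto simp: delete_edges_def)
    then show ?thesis using hypercube_like_line_degree[OF Q that] by simp
  qed
  have paths: "\<exists>P. finite P \<and> card P = min (degree ?H u) (degree ?H v) \<and>
      (\<forall>p \<in> P. is_path ?H u v p) \<and> pairwise (\<lambda>p q. disjnt (path_edges p) (path_edges q)) P"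
    if uv: "u \<in> edges Q" "v \<in> edges Q" "u \<noteq> v" for u v
  proof (rule Menger_edge[OF H])
    fix S assume S: "S \<subseteq> verts ?H" "u \<in> S" "v \<notin> S"
    have finS: "finite S" "finite (edges Q - S)" using S V finE finite_subset by auto
    consider "card S \<le> 2" | "card (edges Q - S) \<le> 2" | "3 \<le> card S" "3 \<le> card (edges Q - S)"
      by linarith
    then show "min (degree ?H u) (degree ?H v) \<le> card (edge_cut ?H S)"
    proof cases
      case 1
      then have "degree ?H u \<le> card (edge_cut ?H S)"
        using degree_le_small_edge_cut[OF H finS(1) S(2,1)] deg2 by blast
      then show ?thesis by simp
    next
      case 2
      \<comment> \<open>The small side is now the one containing \<open>v\<close>; a cut and that of
        the complement coincide.\<close>
      then have "degree ?H v \<le> card (edge_cut ?H (edges Q - S))"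
        using degree_le_small_edge_cut[OF H finS(2), of v] deg2 S uv V by blast
      then show ?thesis using edge_cut_complement[OF H S(1)] V by simp
    next
      case 3
      then have "6 * n - 12 \<le> card (edge_cut (line_graph Q) S)"
        using hypercube_like_line_edge_cut[OF Q n] S V by simp
      moreover have "card (edge_cut (line_graph Q) S) - card F \<le> card (edge_cut ?H S)"
        unfolding edge_cut_delete_edges using F(1) by (rule diff_card_le_card_Diff)
      \<comment> \<open>The difference of 6n - 12 and 4n - 10 is 2n - 2, which bounds every degree
        in \<open>?H\<close>.\<close>
      ultimately have "2 * n - 2 \<le> card (edge_cut ?H S)" using F(2) n by linarith
      then show ?thesis using degle[OF uv(1)] by linarith
    qed
  qed (use uv V in auto)
  \<comment> \<open>Connectedness follows from the same path systems, which are nonempty because all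
    degrees are at least 2.\<close>
  have "\<exists>p. is_path ?H u v p" if "u \<in> edges Q" "v \<in> edges Q" for u v
  proof (cases "u = v")
    case True
    then show ?thesis using that V by (intro exI[of _ "[u]"]) (simp add: is_path_def)
  next
    case False
    from paths[OF that False] obtain P where
      P: "card P = min (degree ?H u) (degree ?H v)" "\<forall>p \<in> P. is_path ?H u v p" by blast
    have "card P \<noteq> 0" using P(1) deg2[of u] deg2[of v] that V by simp
    then have "P \<noteq> {}" by auto
    then show ?thesis using P(2) by blast
  qed
  then show ?thesis
    using paths ne unfolding strongly_Menger_edge_connected_def connected_graph_def V by blast
qed

lemma line_graph_conditional_eft:
  assumes Q: "hypercube_like n Q" and n: "n \<ge> 4"
  shows "conditional_eft_strongly_Menger (4 * n - 10) (line_graph Q)"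
proof -
  have G: "simple_graph Q" by (rule hypercube_like_simple[OF Q])
  have L: "delete_edges (line_graph Q) {} = line_graph Q"
    by (simp add: delete_edges_def)
  have "2 \<le> 2 * n - 2" using n by linarith
  then have "2 \<le> min_degree (line_graph Q)"
    using min_degree_ge_iff[of "line_graph Q" 2] hypercube_like_line_degree[OF Q]
      simple_graph_finite_edges[OF G] hypercube_like_edges_nonempty[OF Q n] by simp
  \<comment> \<open>Connectedness of the line graph itself is the case of no faults.\<close>
  then have "connected_graph (line_graph Q)"
    using line_graph_faulty_strongly_Menger[OF Q n, of "{}"] L
    by (simp add: strongly_Menger_edge_connected_def)
  then show ?thesis
    using line_graph_faulty_strongly_Menger[OF Q n]
    by (simp add: conditional_eft_strongly_Menger_def)
qed

section \<open>Sharpness of the bound 4n - 10\<close>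

text \<open>For three edges \<open>u\<close>, \<open>w\<close>, \<open>x\<close> of the network at a common vertex, delete all edges of the line
  graph that leave the triangle from \<open>w\<close> or \<open>x\<close>, except one: \<open>u\<close> keeps its full degree \<open>2n - 2\<close>,
  but only \<open>(2n - 4) + 1\<close> edges leave the triangle.\<close>

lemma line_graph_faulty_not_strongly_Menger:
  assumes Q: "hypercube_like n Q" and n: "n \<ge> 4"
  shows "\<exists>F \<subseteq> edges (line_graph Q). finite F \<and> card F = 4 * n - 9 \<and>
    2 \<le> min_degree (delete_edges (line_graph Q) F) \<and>
    \<not> strongly_Menger_edge_connected (delete_edges (line_graph Q) F)"
proof -
  have G: "simple_graph Q" by (rule hypercube_like_simple[OF Q])
  have L: "simple_graph (line_graph Q)" by (rule simple_line_graph[OF G])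
  have finE: "finite (edges Q)" by (rule simple_graph_finite_edges[OF G])
  have cV: "card (verts Q) \<ge> 2 ^ 4"
    unfolding hypercube_like_card_verts[OF Q] using n by (intro power_increasing) auto
  obtain a where a: "a \<in> verts Q" using cV by fastforce
  have "3 \<le> card {e \<in> edges Q. a \<in> e}"
    using hypercube_like_degree[OF Q a] n by (simp add: degree_def)
  then obtain T where "T \<subseteq> {e \<in> edges Q. a \<in> e}" "card T = 3"
    using obtain_subset_with_card_n by metis
  then obtain u w x where e: "u \<in> edges Q" "w \<in> edges Q" "x \<in> edges Q"
    and ae: "a \<in> u" "a \<in> w" "a \<in> x" and ne: "u \<noteq> w" "u \<noteq> x" "w \<noteq> x"
    by (auto simp: card_3_iff)
  obtain b where b: "w = {a, b}"
    using e(2) by (rule simple_graphE[OF G]) (use ae in auto)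
  obtain c where c: "x = {a, c}"
    using e(3) by (rule simple_graphE[OF G]) (use ae in auto)
  \<comment> \<open>The second terminal must not touch \<open>w\<close> or \<open>x\<close>, so that
    no deleted edge of the line graph ends in it.\<close>
  obtain v where v: "v \<in> edges Q" "v \<inter> {a, b, c} = {}"
  proof -
    have "\<not> verts Q \<subseteq> {a, b, c}"
    proof
      assume "verts Q \<subseteq> {a, b, c}"
      then have "card (verts Q) \<le> card {a, b, c}" by (rule card_mono[rotated]) simp
      then show False using cV by (simp add: card_insert_if split: if_splits)
    qed
    then obtain z where z: "z \<in> verts Q" "z \<notin> {a, b, c}" by blast
    \<comment> \<open>At least four edges meet in \<open>z\<close>, and at most three of them lead
      to \<open>a\<close>, \<open>b\<close> or \<open>c\<close>.\<close>
    have "\<not> {e \<in> edges Q. z \<in> e} \<subseteq> {{z, a}, {z, b}, {z, c}}"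
    proof
      assume "{e \<in> edges Q. z \<in> e} \<subseteq> {{z, a}, {z, b}, {z, c}}"
      then have "degree Q z \<le> card {{z, a}, {z, b}, {z, c}}"
        unfolding degree_def by (rule card_mono[rotated]) simp
      then show False 
        using hypercube_like_degree[OF Q z(1)] n by (simp add: card_insert_if split: if_splits)
    qed
    then obtain d where d: "d \<in> edges Q" "z \<in> d" "d \<notin> {{z, a}, {z, b}, {z, c}}" by blast
    obtain y where "d = {z, y}"
      using d(1) by (rule simple_graphE[OF G]) (use d in auto)
    then show thesis using that[of d] d z by auto
  qed
  let ?L = "line_graph Q"
  define I where "I e = {d \<in> edges ?L. e \<in> d}" for e
  have finI: "finite (I e)" for e unfolding I_def by (rule finite_incident_edges[OF L])
  have cI: "card (I e) = 2 * n - 2" if "e \<in> edges Q" for e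
    using hypercube_like_line_degree[OF Q that] by (simp add: I_def degree_def)
  have pair: "d = {p, q}" if "d \<in> edges ?L" "p \<in> d" "q \<in> d" "p \<noteq> q" for d p q
    using that(1) by (rule simple_graphE[OF L]) (use that in auto)
  have tri: "{u, w} \<in> edges ?L" "{u, x} \<in> edges ?L" "{w, x} \<in> edges ?L"
    using e ae ne by (auto simp: line_graph_edge_iff)
  \<comment> \<open>The edges leaving the triangle from \<open>w\<close>, \<open>x\<close> and
    \<open>u\<close>: each vertex has 2n - 2 incident edges, two of them in the triangle.\<close>
  define A where "A = I w - {{w, u}, {w, x}}"
  define B where "B = I x - {{x, u}, {x, w}}"
  define C where "C = I u - {{u, w}, {u, x}}"
  have cABC: "card A = 2 * n - 4" "card B = 2 * n - 4" "card C = 2 * n - 4"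
  proof -
    have diff: "card (I p - {{p, q}, {p, r}}) = 2 * n - 4"
      if "p \<in> edges Q" "{p, q} \<in> edges ?L" "{p, r} \<in> edges ?L" "q \<noteq> r" for p q r
    proof -
      have "{p, q} \<noteq> {p, r}" using that(4) by (auto simp: doubleton_eq_iff)
      moreover have "{{p, q}, {p, r}} \<subseteq> I p" using that by (simp add: I_def)
      ultimately show ?thesis using cI[OF that(1)] by (simp add: card_Diff_subset)
    qed
    show "card A = 2 * n - 4" "card B = 2 * n - 4" "card C = 2 * n - 4"
      unfolding A_def B_def C_def
      by (rule diff; use e tri ne in \<open>simp add: insert_commute\<close>)+
  qed
  have fin: "finite A" "finite B" "finite C" using finI by (simp_all add: A_def B_def C_def)
  have AB: "A \<inter> B = {}"
  proof -
    have "d = {w, x}" if "d \<in> edges ?L" "w \<in> d" "x \<in> d" for d by (rule pair[OF that ne(3)])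
    then show ?thesis unfolding A_def B_def I_def by blast
  qed
  have "B \<noteq> {}" using cABC(2) n by auto
  then obtain f0 where f0: "f0 \<in> B" by blast
  \<comment> \<open>Deleting all of \<open>A\<close> and \<open>B\<close> would take 4n - 8 edges.
    Sparing \<open>f0\<close> gives 4n - 9, the first size beyond the tolerated one, and still
    leaves the cut one edge short.\<close>
  define F where "F = A \<union> (B - {f0})"
  let ?H = "delete_edges ?L F"
  have FL: "F \<subseteq> edges ?L" by (auto simp: F_def A_def B_def I_def)
  have finF: "finite F" using fin by (simp add: F_def)
  have "card F = card A + card (B - {f0})"
    unfolding F_def using fin AB by (intro card_Un_disjoint) auto
  then have cF: "card F = 4 * n - 9"
    using cABC fin f0 n by (simp add: card_Diff_singleton)
  have Fwx: "w \<in> d \<or> x \<in> d" if "d \<in> F" for d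
    using that by (auto simp: F_def A_def B_def I_def)
  have degH: "degree ?H e = card (I e - F)" for e
  proof -
    have "{d \<in> edges ?H. e \<in> d} = I e - F" by (auto simp: delete_edges_def I_def)
    then show ?thesis by (simp add: degree_def)
  qed
  have deg_u: "degree ?H u = 2 * n - 2"
  proof -
    have "d = {w, u}" if "d \<in> edges ?L" "w \<in> d" "u \<in> d" for d
      by (rule pair[OF that ne(1)[symmetric]])
    moreover have "d = {x, u}" if "d \<in> edges ?L" "x \<in> d" "u \<in> d" for d
      by (rule pair[OF that ne(2)[symmetric]])
    ultimately have "I u \<inter> F = {}" unfolding F_def A_def B_def I_def by blast
    then have "I u - F = I u" by blast
    then show ?thesis using degH cI[OF e(1)] by simp
  qed
  have deg_v: "degree ?H v = 2 * n - 2"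
  proof -
    have vw: "v \<inter> w = {}" "v \<inter> x = {}" "v \<noteq> w" "v \<noteq> x" using v b c by auto
    have "d \<notin> F" if "d \<in> I v" for d
    proof
      assume "d \<in> F"
      then have "d = {v, w} \<or> d = {v, x}"
        using Fwx[of d] pair[of d v w] pair[of d v x] vw that by (auto simp: I_def)
      then show False using that vw by (auto simp: I_def line_graph_edge_iff)
    qed
    then have "I v - F = I v" by blast
    then show ?thesis using degH cI[OF v(1)] by simp
  qed
  \<comment> \<open>\<open>w\<close> and \<open>x\<close> keep their two triangle edges; any other
    vertex loses at most its edges to \<open>w\<close> and \<open>x\<close>.\<close>
  have deg2: "2 \<le> degree ?H p" if p: "p \<in> edges Q" for p
  proof -
    consider "p = w" | "p = x" | "p \<noteq> w" "p \<noteq> x" by blast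
    then show ?thesis
    proof cases
      case 1
      have "{{w, u}, {w, x}} \<subseteq> I w - F"
        using tri ne by (auto simp: I_def F_def A_def B_def insert_commute)
      moreover have "card {{w, u}, {w, x}} = 2" using ne by (simp add: doubleton_eq_iff)
      ultimately show ?thesis
        unfolding degH 1 using card_mono[of "I w - F" "{{w, u}, {w, x}}"] finI[of w] by simp
    next
      case 2
      have "{{x, u}, {x, w}} \<subseteq> I x - F"
        using tri ne by (auto simp: I_def F_def A_def B_def insert_commute)
      moreover have "card {{x, u}, {x, w}} = 2" using ne by (simp add: doubleton_eq_iff)
      ultimately show ?thesis
        unfolding degH 2 using card_mono[of "I x - F" "{{x, u}, {x, w}}"] finI[of x] by simp
    next
      case 3
      have "d \<in> {{p, w}, {p, x}}" if "d \<in> I p" "d \<in> F" for d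
        using Fwx[OF that(2)] pair[of d p w] pair[of d p x] 3 that(1) by (auto simp: I_def)
      then have "I p - {{p, w}, {p, x}} \<subseteq> I p - F" by blast
      then have "card (I p - {{p, w}, {p, x}}) \<le> card (I p - F)"
        using finI by (intro card_mono) auto
      moreover have "card (I p) - card {{p, w}, {p, x}} \<le> card (I p - {{p, w}, {p, x}})"
        by (rule diff_card_le_card_Diff) simp
      moreover have "card {{p, w}, {p, x}} \<le> 2" by (simp add: card_insert_if)
      ultimately show ?thesis unfolding degH using cI[OF p] n by linarith
    qed
  qed
  have V: "verts ?H = edges Q" by (simp add: delete_edges_def)
  have mind: "2 \<le> min_degree ?H"
    using min_degree_ge_iff[of ?H 2] deg2 V finE e by auto
  have "\<not> strongly_Menger_edge_connected ?H"
  proof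
    assume "strongly_Menger_edge_connected ?H"
    moreover have "u \<noteq> v" using v ae by auto
    ultimately obtain P where P: "card P = min (degree ?H u) (degree ?H v)"
        "\<forall>p \<in> P. is_path ?H u v p" "pairwise (\<lambda>p q. disjnt (path_edges p) (path_edges q)) P"
      using e(1) v(1) V unfolding strongly_Menger_edge_connected_def by blast
    let ?S = "{u, w, x}"
    \<comment> \<open>What still leaves the triangle is \<open>C\<close> and \<open>f0\<close>, at
      most 2n - 3 edges, while \<open>u\<close> and \<open>v\<close> both have degree 2n -
      2.\<close>
    have sub: "edge_cut ?H ?S \<subseteq> insert f0 C"
    proof
      fix d assume "d \<in> edge_cut ?H ?S"
      then have d: "d \<in> edges ?L" "d \<notin> F" "u \<in> d \<or> w \<in> d \<or> x \<in> d" "\<not> d \<subseteq> ?S"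
        by (auto simp: edge_cut_def delete_edges_def)
      then have dn: "d \<noteq> {u, w}" "d \<noteq> {u, x}" "d \<noteq> {w, u}" "d \<noteq> {w, x}" "d \<noteq> {x, u}" "d \<noteq> {x, w}"
        by auto
      from d(3) consider "u \<in> d" | "w \<in> d" | "x \<in> d" by blast
      then show "d \<in> insert f0 C"
      proof cases
        case 1
        then show ?thesis using d(1) dn by (simp add: C_def I_def)
      next
        case 2
        then show ?thesis using d(1,2) dn by (simp add: F_def A_def I_def)
      next
        case 3
        then show ?thesis using d(1,2) dn by (simp add: F_def B_def I_def)
      qed
    qed
    have "v \<notin> ?S" using v ae by auto
    then have "card P \<le> card (edge_cut ?H ?S)"
      using sub fin(3) finite_subset P by (intro disjoint_paths_le_edge_cut[of _ _ u v]) auto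
    also have "\<dots> \<le> card (insert f0 C)" using sub fin(3) by (intro card_mono) auto
    also have "\<dots> \<le> Suc (2 * n - 4)" using fin(3) cABC(3) by (simp add: card_insert_if)
    finally show False using P(1) deg_u deg_v n by simp
  qed
  then show ?thesis using FL finF cF mind by blast
qed

theorem theorem4p2:
  fixes n :: nat and Q :: "'a graph"
  assumes "n \<ge> 4" and "hypercube_like n Q"
  shows "conditional_eft_strongly_Menger (4 * n - 10) (line_graph Q) \<and>
         (\<forall>k > 4 * n - 10. \<not> conditional_eft_strongly_Menger k (line_graph Q))"
proof (intro conjI allI impI)
  show "conditional_eft_strongly_Menger (4 * n - 10) (line_graph Q)"
    by (rule line_graph_conditional_eft[OF assms(2,1)])
next
  fix k assume "4 * n - 10 < k"
  \<comment> \<open>Since \<open>n\<close> is at least 4, the truncated subtractions are exact and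
    4n - 9 follows 4n - 10; one fault set of this size refutes every larger
    \<open>k\<close>.\<close>
  then have k: "4 * n - 9 \<le> k" using assms(1) by linarith
  obtain F where "F \<subseteq> edges (line_graph Q)" "finite F" "card F = 4 * n - 9"
      "2 \<le> min_degree (delete_edges (line_graph Q) F)"
      "\<not> strongly_Menger_edge_connected (delete_edges (line_graph Q) F)"
    using line_graph_faulty_not_strongly_Menger[OF assms(2,1)] by blast
  then show "\<not> conditional_eft_strongly_Menger k (line_graph Q)"
    using k unfolding conditional_eft_strongly_Menger_def by metis
qed

end
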